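(* Let $R$ be a commutative ring with non-zero identity, let $I$ be an ideal of $R$ and let $N$ be a submodule of a finitely generated faithful multiplication $R$-module $M$. Then: (1) $I$ is a 1-absorbing primary ideal of $R$ if and only if $IM$ is a 1-absorbing primary submodule of $M$. (2) $N$ is a 1-absorbing primary submodule of $M$ if and only if $(N:_R M)$ is a 1-absorbing primary ideal of $R$. (3) $N$ is a 1-absorbing primary submodule of $M$ if and only if $N=JM$ for some 1-absorbing primary ideal $J$ of $R$.
   Context: All rings are commutative with non-zero identity and all modules are unitary. For a submodule $N$ of an $R$-module $M$, $(N:_R M)=\{r\in R: rM\subseteq N\}$. A proper submodule $P$ of $M$ is prime if for $a\in R$, $m\in M$, $am\in P$ implies $m\in P$ or $a\in (P:_R M)$. $M\text{-}\mathrm{rad}(N)$ is the intersection of all prime submodules of $M$ containing $N$, and $M\text{-}\mathrm{rad}(N)=M$ if there is no such prime submodule. A proper submodule $N$ of $M$ is a 1-absorbing primary submodule if whenever $a,b\in R$ are non-unit elements and $m\in M$ with $abm\in N$, then $ab\in (N:_R M)$ or $m\in M\text{-}\mathrm{rad}(N)$. A proper ideal $I$ of $R$ is a 1-absorbing primary ideal if whenever $a,b,c$ are non-unit elements of $R$ with $abc\in I$, then $ab\in I$ or $c\in\sqrt{I}$, where $\sqrt I$ is the radical of $I$. An $R$-module $M$ is a multiplication module if every submodule of $M$ has the form $IM$ for some ideal $I$ of $R$. *)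

theory Defs
  imports "HOL-Algebra.Ideal" "HOL-Algebra.Module"
begin

definition colon :: "('a, 'r) ring_scheme \<Rightarrow> ('a, 'b, 'm) module_scheme \<Rightarrow> 'b set \<Rightarrow> 'a set" where
  "colon R M N = {r \<in> carrier R. \<forall>m \<in> carrier M. r \<odot>\<^bsub>M\<^esub> m \<in> N}"

definition prime_submodule ::
  "('a, 'r) ring_scheme \<Rightarrow> ('a, 'b, 'm) module_scheme \<Rightarrow> 'b set \<Rightarrow> bool" where
  "prime_submodule R M P \<longleftrightarrow>
     submodule P R M \<and> P \<noteq> carrier M \<and>
     (\<forall>a \<in> carrier R. \<forall>m \<in> carrier M. a \<odot>\<^bsub>M\<^esub> m \<in> P \<longrightarrow> m \<in> P \<or> a \<in> colon R M P)"

definition module_radical ::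
  "('a, 'r) ring_scheme \<Rightarrow> ('a, 'b, 'm) module_scheme \<Rightarrow> 'b set \<Rightarrow> 'b set" where
  "module_radical R M N =
     (if \<exists>P. prime_submodule R M P \<and> N \<subseteq> P
      then \<Inter>{P. prime_submodule R M P \<and> N \<subseteq> P}
      else carrier M)"

definition ideal_radical :: "('a, 'r) ring_scheme \<Rightarrow> 'a set \<Rightarrow> 'a set" where
  "ideal_radical R I = {r \<in> carrier R. \<exists>n::nat. n > 0 \<and> r [^]\<^bsub>R\<^esub> n \<in> I}"

definition one_absorbing_primary_submodule ::
  "('a, 'r) ring_scheme \<Rightarrow> ('a, 'b, 'm) module_scheme \<Rightarrow> 'b set \<Rightarrow> bool" where
  "one_absorbing_primary_submodule R M N \<longleftrightarrow>
     submodule N R M \<and> N \<noteq> carrier M \<and>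
     (\<forall>a \<in> carrier R - Units R. \<forall>b \<in> carrier R - Units R. \<forall>m \<in> carrier M.
        (a \<otimes>\<^bsub>R\<^esub> b) \<odot>\<^bsub>M\<^esub> m \<in> N \<longrightarrow>
        a \<otimes>\<^bsub>R\<^esub> b \<in> colon R M N \<or> m \<in> module_radical R M N)"

definition one_absorbing_primary_ideal :: "('a, 'r) ring_scheme \<Rightarrow> 'a set \<Rightarrow> bool" where
  "one_absorbing_primary_ideal R I \<longleftrightarrow>
     ideal I R \<and> I \<noteq> carrier R \<and>
     (\<forall>a \<in> carrier R - Units R. \<forall>b \<in> carrier R - Units R. \<forall>c \<in> carrier R - Units R.
        a \<otimes>\<^bsub>R\<^esub> b \<otimes>\<^bsub>R\<^esub> c \<in> I \<longrightarrow> a \<otimes>\<^bsub>R\<^esub> b \<in> I \<or> c \<in> ideal_radical R I)"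

text \<open>The product \<open>IM\<close>: all non-empty finite sums of elements \<open>i \<odot> m\<close>, in the style of
  \<open>ideal_prod\<close>. It contains zero as soon as \<open>I\<close> is non-empty, in particular for every ideal.\<close>

inductive_set ideal_smult :: "('a, 'b, 'm) module_scheme \<Rightarrow> 'a set \<Rightarrow> 'b set"
  for M and I where
    smult: "\<lbrakk>i \<in> I; m \<in> carrier M\<rbrakk> \<Longrightarrow> i \<odot>\<^bsub>M\<^esub> m \<in> ideal_smult M I"
  | sum: "\<lbrakk>x \<in> ideal_smult M I; y \<in> ideal_smult M I\<rbrakk> \<Longrightarrow> x \<oplus>\<^bsub>M\<^esub> y \<in> ideal_smult M I"

lemma (in module) ideal_smult_submodule:
  assumes "ideal I R"
  shows "submodule (ideal_smult M I) R M"
proof -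
  interpret I: ideal I R by fact
  have carr: "x \<in> carrier M" if "x \<in> ideal_smult M I" for x
    using that by induction (auto intro: I.Icarr)
  have smul: "a \<odot>\<^bsub>M\<^esub> x \<in> ideal_smult M I" if a: "a \<in> carrier R" and "x \<in> ideal_smult M I" for a x
    using that(2)
  proof induction
    case (smult i m)
    then have "a \<odot>\<^bsub>M\<^esub> (i \<odot>\<^bsub>M\<^esub> m) = (a \<otimes> i) \<odot>\<^bsub>M\<^esub> m"
      using a by (simp add: smult_assoc1 I.Icarr)
    with smult a show ?case
      by (simp add: ideal_smult.smult I.I_l_closed)
  next
    case (sum x y)
    then show ?case
      using a by (simp add: smult_r_distr carr ideal_smult.sum)
  qed
  show ?thesis
  proof (rule submoduleI)
    show "ideal_smult M I \<subseteq> carrier M" using carr by blast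
    show "\<zero>\<^bsub>M\<^esub> \<in> ideal_smult M I"
      using ideal_smult.smult[of \<zero> I "\<zero>\<^bsub>M\<^esub>" M] I.zero_closed by simp
    show "\<ominus>\<^bsub>M\<^esub> x \<in> ideal_smult M I" if "x \<in> ideal_smult M I" for x
      using smul[of "\<ominus> \<one>" x] that carr by (simp add: smult_l_minus)
  qed (auto intro: smul ideal_smult.sum)
qed

definition finitely_generated_module ::
  "('a, 'r) ring_scheme \<Rightarrow> ('a, 'b, 'm) module_scheme \<Rightarrow> bool" where
  "finitely_generated_module R M \<longleftrightarrow>
     (\<exists>S. finite S \<and> S \<subseteq> carrier M \<and> carrier M = \<Inter>{N. submodule N R M \<and> S \<subseteq> N})"

definition faithful_module ::
  "('a, 'r) ring_scheme \<Rightarrow> ('a, 'b, 'm) module_scheme \<Rightarrow> bool" where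
  "faithful_module R M \<longleftrightarrow>
     (\<forall>r \<in> carrier R. (\<forall>m \<in> carrier M. r \<odot>\<^bsub>M\<^esub> m = \<zero>\<^bsub>M\<^esub>) \<longrightarrow> r = \<zero>\<^bsub>R\<^esub>)"

definition multiplication_module ::
  "('a, 'r) ring_scheme \<Rightarrow> ('a, 'b, 'm) module_scheme \<Rightarrow> bool" where
  "multiplication_module R M \<longleftrightarrow>
     (\<forall>N. submodule N R M \<longrightarrow> (\<exists>I. ideal I R \<and> N = ideal_smult M I))"

end

theory Submission
  imports Defs
begin

text \<open>
  The map \<open>I \<mapsto> IM\<close> identifies the ideals of \<open>R\<close> with the submodules of \<open>M\<close>, with inverse
  \<open>N \<mapsto> (N : M)\<close>, and this identification carries radicals to radicals.  Once that is known,
  the 1-absorbing primary condition for \<open>IM\<close> is the one for \<open>I\<close>, because an element \<open>m\<close> of \<open>M\<close>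
  can be replaced by an ideal \<open>K\<close> with \<open>Rm = KM\<close>.

  That \<open>N = (N : M)M\<close> is immediate for a multiplication module (\<open>submodule_eq_colon_smult\<close>).
  The cancellation law \<open>(IM : M) = I\<close> is the heart of the matter (\<open>colon_ideal_smult\<close>).  If
  \<open>rM \<subseteq> IM\<close> but \<open>r \<notin> I\<close>, some prime ideal \<open>p\<close> contains \<open>(I : r)\<close>.  Writing
  \<open>Rx = KM\<close>, every \<open>k \<in> K\<close> satisfies \<open>k r x = j x\<close> with \<open>j \<in> I\<close>; since \<open>kM \<subseteq> Rx\<close>,
  faithfulness turns this into \<open>k k r = j k \<in> I\<close>, so \<open>k k \<in> p\<close> and \<open>k \<in> p\<close>.  Hence
  \<open>x \<in> pM\<close> for all \<open>x\<close>, that is \<open>M = pM\<close>.  This is impossible by a form of Nakayama's lemma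
  (\<open>ideal_smult_eq_carrier_imp_one\<close>), which needs no determinants here: in a multiplication module,
  \<open>M = pM\<close> already gives \<open>Rx = px\<close> for each single \<open>x\<close>.

  Cancellation makes \<open>pM\<close> a prime submodule for every prime ideal \<open>p\<close>
  (\<open>prime_ideal_smult\<close>).  Together with Krull's description of the radical of an ideal by primes
  (\<open>exists_prime_outside_radical\<close>) this yields \<open>(M-rad(IM) : M) = \<surd>I\<close>
  (\<open>colon_module_radical\<close>).
\<close>

section \<open>Prime ideals and the radical\<close>

lemma (in ring) ideal_chain_Union:
  assumes ne: "C \<noteq> {}" and ideals: "\<And>J. J \<in> C \<Longrightarrow> ideal J R"
    and chain: "\<And>J K. J \<in> C \<Longrightarrow> K \<in> C \<Longrightarrow> J \<subseteq> K \<or> K \<subseteq> J"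
  shows "ideal (\<Union>C) R"
proof (intro idealI add.subgroupI)
  note sub = ideals[THEN ideal.axioms(1)]
  show "\<Union>C \<subseteq> carrier R"
    using ideals ideal.Icarr by fast
  show "\<Union>C \<noteq> {}"
    using ne sub additive_subgroup.zero_closed by fast
  show "\<ominus> x \<in> \<Union>C" if "x \<in> \<Union>C" for x
    using that sub additive_subgroup.a_inv_closed by fast
  show "x \<oplus> y \<in> \<Union>C" if xy: "x \<in> \<Union>C" "y \<in> \<Union>C" for x y
  proof -
    obtain J where J: "J \<in> C" "x \<in> J" "y \<in> J"
      using xy chain by blast
    then have "x \<oplus> y \<in> J"
      using additive_subgroup.a_closed[OF sub] by blast
    with J(1) show ?thesis by blast
  qed
  show "y \<otimes> x \<in> \<Union>C" if "x \<in> \<Union>C" "y \<in> carrier R" for x y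
    using that ideals ideal.I_l_closed by fast
  show "x \<otimes> y \<in> \<Union>C" if "x \<in> \<Union>C" "y \<in> carrier R" for x y
    using that ideals ideal.I_r_closed by fast
qed (fact ring_axioms)

lemma (in cring) ideal_quotient_elem:
  assumes I: "ideal I R" and r: "r \<in> carrier R"
  shows "ideal {x \<in> carrier R. x \<otimes> r \<in> I} R"
proof -
  interpret I: ideal I R by fact
  show ?thesis
  proof (intro idealI add.subgroupI)
    show "{x \<in> carrier R. x \<otimes> r \<in> I} \<noteq> {}"
      using r by (auto intro!: exI[of _ \<zero>])
    show "x \<oplus> y \<in> {x \<in> carrier R. x \<otimes> r \<in> I}"
      if "x \<in> {x \<in> carrier R. x \<otimes> r \<in> I}" "y \<in> {x \<in> carrier R. x \<otimes> r \<in> I}" for x y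
      using that r by (simp add: l_distr)
    show "\<ominus> x \<in> {x \<in> carrier R. x \<otimes> r \<in> I}"
      if "x \<in> {x \<in> carrier R. x \<otimes> r \<in> I}" for x
      using that r by (simp add: l_minus)
    show "y \<otimes> x \<in> {x \<in> carrier R. x \<otimes> r \<in> I}"
      if "x \<in> {x \<in> carrier R. x \<otimes> r \<in> I}" "y \<in> carrier R" for x y
      using that r by (simp add: m_assoc I.I_l_closed)
    then show "x \<otimes> y \<in> {x \<in> carrier R. x \<otimes> r \<in> I}"
      if "x \<in> {x \<in> carrier R. x \<otimes> r \<in> I}" "y \<in> carrier R" for x y
      using that m_comm[of x y] by simp
  qed (auto simp: ring_axioms)
qed

text \<open>
  Krull's theorem: an ideal maximal among those that contain \<open>I\<close> and miss all powers of \<open>c\<close> is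
  prime.  Primality is read off from quotient ideals instead of sums: if \<open>a b \<in> p\<close> and
  \<open>a \<notin> p\<close>, then \<open>(p : b)\<close> is strictly larger than \<open>p\<close>, so some \<open>c\<^sup>n b\<close> lies in \<open>p\<close>; then
  \<open>b \<notin> p\<close> would likewise put a power of \<open>c\<close> into \<open>(p : c\<^sup>n)\<close>, and a power of \<open>c\<close> into \<open>p\<close>.
\<close>
lemma (in cring) exists_prime_outside_radical:
  assumes I: "ideal I R" and c: "c \<in> carrier R" and nrad: "c \<notin> ideal_radical R I"
  obtains p where "primeideal p R" "I \<subseteq> p" "c \<notin> p"
proof -
  interpret I: ideal I R by fact
  define A where "A = {J. ideal J R \<and> I \<subseteq> J \<and> (\<forall>n::nat. c [^] n \<notin> J)}"
  \<comment> \<open>The radical speaks of positive exponents only; an ideal containing \<open>c\<^sup>0\<close> contains \<open>c\<close>.\<close>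
  have pow: "c [^] n \<notin> I" for n :: nat
  proof
    assume n: "c [^] n \<in> I"
    then have "c [^] Suc n \<in> I"
      using c by (simp add: I.I_r_closed)
    with nrad c show False
      unfolding ideal_radical_def by blast
  qed
  have "\<exists>p\<in>A. \<forall>J\<in>A. p \<subseteq> J \<longrightarrow> J = p"
  proof (rule subset_Zorn_nonempty)
    show "A \<noteq> {}"
      using I pow by (auto simp: A_def)
    fix C assume C: "C \<noteq> {}" "subset.chain A C"
    then have "ideal (\<Union>C) R"
      by (intro ideal_chain_Union) (auto simp: A_def pred_on.chain_def)
    then show "\<Union>C \<in> A"
      using C unfolding A_def pred_on.chain_def by blast
  qed
  then obtain p where p: "p \<in> A" and max: "\<And>J. J \<in> A \<Longrightarrow> p \<subseteq> J \<Longrightarrow> J = p"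
    by blast
  interpret p: ideal p R using p by (simp add: A_def)
  have pow_p: "c [^] n \<notin> p" for n :: nat
    using p by (simp add: A_def)
  \<comment> \<open>The ideal \<open>(p : s)\<close> contains \<open>p\<close>; as soon as it is strictly larger, maximality puts a power
      of \<open>c\<close> into it.\<close>
  have grow: "\<exists>n::nat. c [^] n \<otimes> s \<in> p"
    if s: "s \<in> carrier R" and t: "t \<in> carrier R" "t \<notin> p" "t \<otimes> s \<in> p" for s t
  proof (rule ccontr)
    let ?Q = "{x \<in> carrier R. x \<otimes> s \<in> p}"
    assume "\<not> (\<exists>n::nat. c [^] n \<otimes> s \<in> p)"
    moreover have "p \<subseteq> ?Q"
      using s p.I_r_closed p.Icarr by auto
    ultimately have "?Q \<in> A"
      using ideal_quotient_elem[OF p.is_ideal s] p by (auto simp: A_def)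
    then have "?Q = p"
      using max \<open>p \<subseteq> ?Q\<close> by blast
    with t show False by blast
  qed
  have "primeideal p R"
  proof (rule primeidealI)
    show "carrier R \<noteq> p"
      using pow_p[of 0] by auto
    fix a b assume ab: "a \<in> carrier R" "b \<in> carrier R" "a \<otimes> b \<in> p"
    show "a \<in> p \<or> b \<in> p"
    proof (rule ccontr)
      assume nin: "\<not> (a \<in> p \<or> b \<in> p)"
      obtain n :: nat where n: "c [^] n \<otimes> b \<in> p"
        using grow[of b a] ab nin by blast
      then have "b \<otimes> c [^] n \<in> p"
        using ab c by (simp add: m_comm)
      then obtain m :: nat where "c [^] m \<otimes> c [^] n \<in> p"
        using grow[of "c [^] n" b] ab nin c by blast
      then show False
        using pow_p[of "m + n"] c by (simp add: nat_pow_mult)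
    qed
  qed (fact p.is_ideal is_cring)+
  moreover have "I \<subseteq> p" using p by (simp add: A_def)
  moreover have "c \<notin> p" using pow_p[of 1] c by simp
  ultimately show thesis using that by blast
qed

lemma (in cring) proper_ideal_le_prime:
  assumes I: "ideal I R" and "\<one> \<notin> I"
  obtains p where "primeideal p R" "I \<subseteq> p"
proof -
  have "\<one> \<notin> ideal_radical R I"
    using assms by (simp add: ideal_radical_def)
  then show thesis
    using exists_prime_outside_radical[OF I one_closed] that by blast
qed

section \<open>Residuals and the product of an ideal with a module\<close>

lemma (in module) submodule_zero_closed:
  assumes "submodule N R M"
  shows "\<zero>\<^bsub>M\<^esub> \<in> N"
proof -
  obtain x where x: "x \<in> N" using submoduleE(2)[OF assms] by blast
  then have "\<zero> \<odot>\<^bsub>M\<^esub> x \<in> N" using submoduleE(4)[OF assms] by blast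
  moreover have "x \<in> carrier M" using x submoduleE(1)[OF assms] by blast
  ultimately show ?thesis by simp
qed

lemma (in module) colon_ideal:
  assumes N: "submodule N R M"
  shows "ideal (colon R M N) R"
proof (intro idealI R.add.subgroupI)
  show "colon R M N \<noteq> {}"
    using submodule_zero_closed[OF N] by (auto simp: colon_def intro!: exI[of _ \<zero>])
  show "\<ominus> x \<in> colon R M N" if "x \<in> colon R M N" for x
    using that submoduleE(3)[OF N] by (simp add: colon_def smult_l_minus)
  show "x \<oplus> y \<in> colon R M N" if "x \<in> colon R M N" "y \<in> colon R M N" for x y
    using that submoduleE(5)[OF N] by (simp add: colon_def smult_l_distr)
  show "y \<otimes> x \<in> colon R M N" if "x \<in> colon R M N" "y \<in> carrier R" for x y
    using that submoduleE(4)[OF N] by (simp add: colon_def smult_assoc1)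
  then show "x \<otimes> y \<in> colon R M N" if "x \<in> colon R M N" "y \<in> carrier R" for x y
    using that R.m_comm[of x y] by (simp add: colon_def)
qed (auto simp: colon_def R.ring_axioms)

text \<open>
  Multiplication by \<open>M\<close> and residuation by \<open>M\<close> form a Galois connection between ideals and
  submodules.
\<close>
lemma (in module) ideal_smult_le_iff:
  assumes N: "submodule N R M" and "I \<subseteq> carrier R"
  shows "ideal_smult M I \<subseteq> N \<longleftrightarrow> I \<subseteq> colon R M N"
proof
  assume "ideal_smult M I \<subseteq> N"
  then show "I \<subseteq> colon R M N"
    using assms(2) by (auto simp: colon_def intro: ideal_smult.smult)
next
  assume I: "I \<subseteq> colon R M N"
  show "ideal_smult M I \<subseteq> N"
  proof
    fix x assume "x \<in> ideal_smult M I"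
    then show "x \<in> N"
      by induction (use I submoduleE(5)[OF N] in \<open>auto simp: colon_def\<close>)
  qed
qed

lemma ideal_smult_mono: "I \<subseteq> J \<Longrightarrow> ideal_smult M I \<subseteq> ideal_smult M J"
proof
  fix x assume "I \<subseteq> J" "x \<in> ideal_smult M I"
  from this(2,1) show "x \<in> ideal_smult M J"
    by induction (auto intro: ideal_smult.intros)
qed

lemma (in module) ideal_smult_carrier: "ideal_smult M (carrier R) = carrier M"
proof
  show "ideal_smult M (carrier R) \<subseteq> carrier M"
    using submoduleE(1)[OF ideal_smult_submodule[OF R.oneideal]] .
  show "carrier M \<subseteq> ideal_smult M (carrier R)"
    using ideal_smult.smult[of \<one> "carrier R" _ M] by fastforce
qed

lemma (in module) ideal_smult_elem_submodule:
  assumes J: "ideal J R" and x: "x \<in> carrier M"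
  shows "submodule ((\<lambda>j. j \<odot>\<^bsub>M\<^esub> x) ` J) R M"
proof -
  interpret J: ideal J R by fact
  show ?thesis
  proof (rule submoduleI)
    show "(\<lambda>j. j \<odot>\<^bsub>M\<^esub> x) ` J \<subseteq> carrier M" using x J.Icarr by auto
    show "\<zero>\<^bsub>M\<^esub> \<in> (\<lambda>j. j \<odot>\<^bsub>M\<^esub> x) ` J"
      using x by (auto intro!: image_eqI[of _ _ \<zero>])
    show "\<ominus>\<^bsub>M\<^esub> y \<in> (\<lambda>j. j \<odot>\<^bsub>M\<^esub> x) ` J" if "y \<in> (\<lambda>j. j \<odot>\<^bsub>M\<^esub> x) ` J" for y
      using that x J.Icarr by (auto simp flip: smult_l_minus)
    show "y \<oplus>\<^bsub>M\<^esub> z \<in> (\<lambda>j. j \<odot>\<^bsub>M\<^esub> x) ` J"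
      if "y \<in> (\<lambda>j. j \<odot>\<^bsub>M\<^esub> x) ` J" "z \<in> (\<lambda>j. j \<odot>\<^bsub>M\<^esub> x) ` J" for y z
      using that x J.Icarr by (auto simp flip: smult_l_distr)
    show "r \<odot>\<^bsub>M\<^esub> y \<in> (\<lambda>j. j \<odot>\<^bsub>M\<^esub> x) ` J"
      if "r \<in> carrier R" "y \<in> (\<lambda>j. j \<odot>\<^bsub>M\<^esub> x) ` J" for r y
      using that x J.Icarr J.I_l_closed by (auto simp flip: smult_assoc1)
  qed
qed

lemma (in module) submodule_eq_colon_smult:
  assumes mult: "multiplication_module R M" and N: "submodule N R M"
  shows "N = ideal_smult M (colon R M N)"
proof
  obtain J where J: "ideal J R" "N = ideal_smult M J"
    using mult N unfolding multiplication_module_def by blast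
  have "J \<subseteq> carrier R"
    using ideal.Icarr[OF J(1)] by blast
  then have "J \<subseteq> colon R M N"
    using ideal_smult_le_iff[OF N] J(2) by blast
  then have "ideal_smult M J \<subseteq> ideal_smult M (colon R M N)"
    by (rule ideal_smult_mono)
  then show "N \<subseteq> ideal_smult M (colon R M N)"
    by (simp only: J(2)[symmetric])
  show "ideal_smult M (colon R M N) \<subseteq> N"
    using ideal_smult_le_iff[OF N, of "colon R M N"] by (auto simp: colon_def)
qed

section \<open>Cyclic submodules and cancellation\<close>

lemma (in module) cyclic_eq_ideal_smult:
  assumes "multiplication_module R M" and x: "x \<in> carrier M"
  obtains K where "ideal K R" "ideal_smult M K = (\<lambda>r. r \<odot>\<^bsub>M\<^esub> x) ` carrier R"
    "x \<in> ideal_smult M K"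
proof -
  let ?C = "(\<lambda>r. r \<odot>\<^bsub>M\<^esub> x) ` carrier R"
  obtain K where K: "ideal K R" "?C = ideal_smult M K"
    using assms(1) ideal_smult_elem_submodule[OF R.oneideal x]
    unfolding multiplication_module_def by blast
  have "x \<in> ?C"
    using x by (auto intro!: image_eqI[of _ _ \<one>])
  with K show thesis using that by simp
qed

text \<open>
  This is the inclusion \<open>K(JM) = J(KM) \<subseteq> J(Rx) = Jx\<close>.  Its point is that an element of the set
  on the right is a single multiple of \<open>x\<close>, not a sum.
\<close>
lemma (in module) cyclic_ideal_smult_le:
  assumes x: "x \<in> carrier M" and J: "ideal J R" and K: "ideal K R"
    and cyc: "ideal_smult M K \<subseteq> (\<lambda>r. r \<odot>\<^bsub>M\<^esub> x) ` carrier R"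
    and k: "k \<in> K" and y: "y \<in> ideal_smult M J"
  shows "k \<odot>\<^bsub>M\<^esub> y \<in> (\<lambda>j. j \<odot>\<^bsub>M\<^esub> x) ` J"
  using y
proof induction
  case (smult j m)
  interpret J: ideal J R by fact
  interpret K: ideal K R by fact
  obtain r where r: "r \<in> carrier R" "k \<odot>\<^bsub>M\<^esub> m = r \<odot>\<^bsub>M\<^esub> x"
    using cyc ideal_smult.smult[OF k smult(2)] by blast
  have "k \<odot>\<^bsub>M\<^esub> (j \<odot>\<^bsub>M\<^esub> m) = (j \<otimes> k) \<odot>\<^bsub>M\<^esub> m"
    using smult k J.Icarr K.Icarr by (simp add: smult_assoc1[symmetric] R.m_comm)
  also have "\<dots> = (j \<otimes> r) \<odot>\<^bsub>M\<^esub> x"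
    using smult k J.Icarr K.Icarr r x by (simp add: smult_assoc1)
  finally show ?case
    using smult r by (auto intro: J.I_r_closed)
next
  case (sum y z)
  have "ideal_smult M J \<subseteq> carrier M"
    using submoduleE(1)[OF ideal_smult_submodule[OF J]] .
  with sum(1,2) have "y \<in> carrier M" "z \<in> carrier M" by auto
  then have "k \<odot>\<^bsub>M\<^esub> (y \<oplus>\<^bsub>M\<^esub> z) = k \<odot>\<^bsub>M\<^esub> y \<oplus>\<^bsub>M\<^esub> k \<odot>\<^bsub>M\<^esub> z"
    using ideal.Icarr[OF K k] by (simp add: smult_r_distr)
  then show ?case
    using submoduleE(5)[OF ideal_smult_elem_submodule[OF J x] sum(3,4)] by simp
qed

lemma (in module) annihilated_submodule:
  assumes s: "s \<in> carrier R"
  shows "submodule {x \<in> carrier M. s \<odot>\<^bsub>M\<^esub> x = \<zero>\<^bsub>M\<^esub>} R M"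
proof (rule submoduleI)
  show "r \<odot>\<^bsub>M\<^esub> x \<in> {x \<in> carrier M. s \<odot>\<^bsub>M\<^esub> x = \<zero>\<^bsub>M\<^esub>}"
    if "r \<in> carrier R" "x \<in> {x \<in> carrier M. s \<odot>\<^bsub>M\<^esub> x = \<zero>\<^bsub>M\<^esub>}" for r x
  proof -
    have "s \<odot>\<^bsub>M\<^esub> (r \<odot>\<^bsub>M\<^esub> x) = r \<odot>\<^bsub>M\<^esub> (s \<odot>\<^bsub>M\<^esub> x)"
      using that s smult_assoc1[of r s x] smult_assoc1[of s r x] R.m_comm[of r s] by auto
    then show ?thesis using that s by simp
  qed
qed (use s in \<open>auto simp: smult_r_minus smult_r_distr\<close>)

text \<open>
  A form of Nakayama's lemma.  If \<open>M = pM\<close> and \<open>Rx = KM\<close>, then \<open>Rx = K(pM) \<subseteq> px\<close>, so \<open>x\<close> is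
  killed by \<open>1 - q\<close> for some \<open>q \<in> p\<close>.  Multiplying these factors over a finite set of generators
  gives an element of \<open>1 + p\<close> that kills \<open>M\<close>; faithfulness makes it zero.
\<close>
lemma (in module) ideal_smult_eq_carrier_imp_one:
  assumes mult: "multiplication_module R M" and fg: "finitely_generated_module R M"
    and faith: "faithful_module R M"
    and p: "ideal p R" and all: "ideal_smult M p = carrier M"
  shows "\<one> \<in> p"
proof -
  interpret p: ideal p R by fact
  have fixed: "\<exists>q\<in>p. x = q \<odot>\<^bsub>M\<^esub> x" if x: "x \<in> carrier M" for x
  proof -
    obtain K where K: "ideal K R" "ideal_smult M K = (\<lambda>r. r \<odot>\<^bsub>M\<^esub> x) ` carrier R"
      "x \<in> ideal_smult M K"
      using cyclic_eq_ideal_smult[OF mult x] .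
    have "K \<subseteq> colon R M ((\<lambda>q. q \<odot>\<^bsub>M\<^esub> x) ` p)"
      using cyclic_ideal_smult_le[OF x p K(1)] K(2) all ideal.Icarr[OF K(1)]
      by (auto simp: colon_def)
    then have "ideal_smult M K \<subseteq> (\<lambda>q. q \<odot>\<^bsub>M\<^esub> x) ` p"
      using ideal_smult_le_iff[OF ideal_smult_elem_submodule[OF p x]] ideal.Icarr[OF K(1)]
      by blast
    with K(3) show ?thesis by blast
  qed
  obtain S where S: "finite S" "S \<subseteq> carrier M" "carrier M = \<Inter>{N. submodule N R M \<and> S \<subseteq> N}"
    using fg by (auto simp: finitely_generated_module_def)
  have "\<exists>q\<in>p. \<forall>x\<in>S. (\<one> \<ominus> q) \<odot>\<^bsub>M\<^esub> x = \<zero>\<^bsub>M\<^esub>"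
    using S(1,2)
  proof (induction S rule: finite_induct)
    case empty
    show ?case using p.zero_closed by blast
  next
    case (insert x S)
    obtain q where q: "q \<in> p" "\<And>y. y \<in> S \<Longrightarrow> (\<one> \<ominus> q) \<odot>\<^bsub>M\<^esub> y = \<zero>\<^bsub>M\<^esub>"
      using insert by auto
    obtain t where t: "t \<in> p" "x = t \<odot>\<^bsub>M\<^esub> x"
      using fixed[of x] insert.prems by blast
    have c[simp]: "q \<in> carrier R" "t \<in> carrier R" "x \<in> carrier M"
      using q t insert.prems p.Icarr by auto
    \<comment> \<open>The witness comes from \<open>1 - (q + t - qt) = (1 - q) (1 - t)\<close>.\<close>
    define u where "u = q \<oplus> t \<ominus> q \<otimes> t"
    have u: "\<one> \<ominus> u = (\<one> \<ominus> q) \<otimes> (\<one> \<ominus> t)"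
      unfolding u_def using c by algebra
    have "u \<in> p"
      unfolding u_def a_minus_def using q t c
      by (intro p.a_closed p.a_inv_closed p.I_r_closed) auto
    moreover have "(\<one> \<ominus> u) \<odot>\<^bsub>M\<^esub> x = \<zero>\<^bsub>M\<^esub>"
    proof -
      have "(\<one> \<ominus> t) \<odot>\<^bsub>M\<^esub> x = \<zero>\<^bsub>M\<^esub>"
        unfolding a_minus_def using c t(2)[symmetric]
        by (simp add: smult_l_distr smult_l_minus M.r_neg)
      then show ?thesis unfolding u by (simp add: smult_assoc1)
    qed
    moreover have "(\<one> \<ominus> u) \<odot>\<^bsub>M\<^esub> y = \<zero>\<^bsub>M\<^esub>" if "y \<in> S" for y
    proof -
      have "y \<in> carrier M" using that insert.prems by blast
      have "\<one> \<ominus> u = (\<one> \<ominus> t) \<otimes> (\<one> \<ominus> q)"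
        unfolding u by (simp add: R.m_comm)
      then show ?thesis using q(2)[OF that] \<open>y \<in> carrier M\<close> by (simp add: smult_assoc1)
    qed
    ultimately show ?case by blast
  qed
  then obtain q where q: "q \<in> p" "\<And>x. x \<in> S \<Longrightarrow> (\<one> \<ominus> q) \<odot>\<^bsub>M\<^esub> x = \<zero>\<^bsub>M\<^esub>"
    by blast
  have qc: "q \<in> carrier R" using q p.Icarr by blast
  have "carrier M \<subseteq> {x \<in> carrier M. (\<one> \<ominus> q) \<odot>\<^bsub>M\<^esub> x = \<zero>\<^bsub>M\<^esub>}"
    using annihilated_submodule[of "\<one> \<ominus> q"] q(2) S(2,3) qc by blast
  then have "\<one> \<ominus> q = \<zero>"
    using faith qc unfolding faithful_module_def by blast
  moreover have "\<one> = (\<one> \<ominus> q) \<oplus> q"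
    using qc by algebra
  ultimately have "\<one> = q"
    using qc by simp
  with q(1) show ?thesis by simp
qed

text \<open>
  Cancellation.  The elements \<open>s\<close> with \<open>s r \<in> I\<close> form an ideal \<open>L\<close>, and \<open>r \<in> I\<close> means
  \<open>1 \<in> L\<close>.  A prime ideal above a proper \<open>L\<close> would contain every ideal \<open>K\<close> for which \<open>KM\<close> is
  cyclic, because it contains the squares of the elements of \<open>K\<close>; it would then multiply \<open>M\<close> onto
  itself.
\<close>
lemma (in module) colon_ideal_smult:
  assumes mult: "multiplication_module R M" and fg: "finitely_generated_module R M"
    and faith: "faithful_module R M" and I: "ideal I R"
  shows "colon R M (ideal_smult M I) = I"
proof
  interpret I: ideal I R by fact
  show "I \<subseteq> colon R M (ideal_smult M I)"
    using I.Icarr by (auto simp: colon_def intro: ideal_smult.smult)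
  show "colon R M (ideal_smult M I) \<subseteq> I"
  proof
    fix r assume r: "r \<in> colon R M (ideal_smult M I)"
    then have rc: "r \<in> carrier R" by (simp add: colon_def)
    define L where "L = {s \<in> carrier R. s \<otimes> r \<in> I}"
    have L: "ideal L R"
      unfolding L_def by (rule R.ideal_quotient_elem[OF I rc])
    have "\<one> \<in> L"
    proof (rule ccontr)
      assume "\<one> \<notin> L"
      then obtain p where pp: "primeideal p R" and Lp: "L \<subseteq> p"
        using R.proper_ideal_le_prime[OF L] by blast
      interpret p: primeideal p R by fact
      have "x \<in> ideal_smult M p" if x: "x \<in> carrier M" for x
      proof -
        obtain K where K: "ideal K R" "ideal_smult M K = (\<lambda>r. r \<odot>\<^bsub>M\<^esub> x) ` carrier R"
          "x \<in> ideal_smult M K"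
          using cyclic_eq_ideal_smult[OF mult x] .
        interpret K: ideal K R by fact
        have "k \<in> p" if k: "k \<in> K" for k
        proof -
          have kc: "k \<in> carrier R" using k by (rule K.Icarr)
          have "k \<odot>\<^bsub>M\<^esub> (r \<odot>\<^bsub>M\<^esub> x) \<in> (\<lambda>j. j \<odot>\<^bsub>M\<^esub> x) ` I"
            using cyclic_ideal_smult_le[OF x I K(1) _ k] K(2) r x by (simp add: colon_def)
          then obtain j where j: "j \<in> I" "k \<odot>\<^bsub>M\<^esub> (r \<odot>\<^bsub>M\<^esub> x) = j \<odot>\<^bsub>M\<^esub> x" by blast
          have jc: "j \<in> carrier R" using j I.Icarr by blast
          have zero: "(k \<otimes> r \<ominus> j) \<odot>\<^bsub>M\<^esub> x = \<zero>\<^bsub>M\<^esub>"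
            unfolding a_minus_def using kc rc jc x j(2)
            by (simp add: smult_l_distr smult_l_minus smult_assoc1 M.r_neg)
          \<comment> \<open>\<open>kr - j\<close> kills \<open>x\<close> and \<open>kM \<subseteq> Rx\<close>, so \<open>(kr - j)k\<close> kills \<open>M\<close>.\<close>
          have "((k \<otimes> r \<ominus> j) \<otimes> k) \<odot>\<^bsub>M\<^esub> m = \<zero>\<^bsub>M\<^esub>" if m: "m \<in> carrier M" for m
          proof -
            obtain a where a: "a \<in> carrier R" "k \<odot>\<^bsub>M\<^esub> m = a \<odot>\<^bsub>M\<^esub> x"
              using K(2) ideal_smult.smult[OF k m] by blast
            have "((k \<otimes> r \<ominus> j) \<otimes> k) \<odot>\<^bsub>M\<^esub> m = (k \<otimes> r \<ominus> j) \<odot>\<^bsub>M\<^esub> (a \<odot>\<^bsub>M\<^esub> x)"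
              using kc rc jc m a by (simp add: smult_assoc1)
            also have "\<dots> = a \<odot>\<^bsub>M\<^esub> ((k \<otimes> r \<ominus> j) \<odot>\<^bsub>M\<^esub> x)"
              using kc rc jc x a by (simp add: smult_assoc1[symmetric] R.m_comm)
            also have "\<dots> = \<zero>\<^bsub>M\<^esub>"
              using zero a by simp
            finally show ?thesis .
          qed
          then have "(k \<otimes> r \<ominus> j) \<otimes> k = \<zero>"
            using faith kc rc jc unfolding faithful_module_def by simp
          moreover have "k \<otimes> k \<otimes> r = (k \<otimes> r \<ominus> j) \<otimes> k \<oplus> j \<otimes> k"
            using kc rc jc by algebra
          ultimately have "k \<otimes> k \<otimes> r = j \<otimes> k"
            using kc jc by simp
          then have "k \<otimes> k \<in> L"
            unfolding L_def using j(1) kc by (simp add: I.I_r_closed)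
          then show "k \<in> p"
            using Lp p.I_prime[of k k] kc by blast
        qed
        then have "K \<subseteq> p" by blast
        then show ?thesis
          using K(3) by (rule ideal_smult_mono[THEN subsetD])
      qed
      moreover have "ideal_smult M p \<subseteq> carrier M"
        using submoduleE(1)[OF ideal_smult_submodule[OF p.is_ideal]] .
      ultimately have "\<one> \<in> p"
        using ideal_smult_eq_carrier_imp_one[OF mult fg faith p.is_ideal] by blast
      then show False
        using p.one_imp_carrier p.I_notcarr by blast
    qed
    then show "r \<in> I" using rc by (simp add: L_def)
  qed
qed

text \<open>
  This trades an element of the module for an ideal: with \<open>Rm = KM\<close>, the condition \<open>am \<in> N\<close>
  becomes \<open>aK \<subseteq> (N : M)\<close>, a statement about \<open>R\<close> alone.
\<close>
lemma (in module) cyclic_ideal_mult_le_colon: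
  assumes mult: "multiplication_module R M" and N: "submodule N R M"
    and a: "a \<in> carrier R" and m: "m \<in> carrier M" and am: "a \<odot>\<^bsub>M\<^esub> m \<in> N"
  obtains K where "ideal K R" "m \<in> ideal_smult M K" "\<And>k. k \<in> K \<Longrightarrow> a \<otimes> k \<in> colon R M N"
proof -
  obtain K where K: "ideal K R" "ideal_smult M K = (\<lambda>r. r \<odot>\<^bsub>M\<^esub> m) ` carrier R"
    "m \<in> ideal_smult M K"
    using cyclic_eq_ideal_smult[OF mult m] .
  have "a \<otimes> k \<in> colon R M N" if k: "k \<in> K" for k
  proof -
    have kc: "k \<in> carrier R" using ideal.Icarr[OF K(1) k] .
    have "(a \<otimes> k) \<odot>\<^bsub>M\<^esub> y \<in> N" if y: "y \<in> carrier M" for y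
    proof -
      obtain r where r: "r \<in> carrier R" "k \<odot>\<^bsub>M\<^esub> y = r \<odot>\<^bsub>M\<^esub> m"
        using K(2) ideal_smult.smult[OF k y] by blast
      have "(a \<otimes> k) \<odot>\<^bsub>M\<^esub> y = a \<odot>\<^bsub>M\<^esub> (r \<odot>\<^bsub>M\<^esub> m)"
        using a kc y r by (simp add: smult_assoc1)
      also have "\<dots> = r \<odot>\<^bsub>M\<^esub> (a \<odot>\<^bsub>M\<^esub> m)"
        using a m r by (simp add: smult_assoc1[symmetric] R.m_comm)
      finally show ?thesis using submoduleE(4)[OF N r(1) am] by simp
    qed
    then show ?thesis using a kc by (simp add: colon_def)
  qed
  with K that show thesis by blast
qed

section \<open>Prime submodules and the module radical\<close>

lemma (in module) prime_ideal_smult: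
  assumes mult: "multiplication_module R M" and fg: "finitely_generated_module R M"
    and faith: "faithful_module R M" and p: "primeideal p R"
  shows "prime_submodule R M (ideal_smult M p)"
proof -
  interpret p: primeideal p R by fact
  have sub: "submodule (ideal_smult M p) R M"
    by (rule ideal_smult_submodule[OF p.is_ideal])
  have colon: "colon R M (ideal_smult M p) = p"
    by (rule colon_ideal_smult[OF mult fg faith p.is_ideal])
  have "ideal_smult M p \<noteq> carrier M"
    using ideal_smult_eq_carrier_imp_one[OF mult fg faith p.is_ideal] p.one_imp_carrier p.I_notcarr by blast
  moreover have "m \<in> ideal_smult M p \<or> a \<in> p"
    if a: "a \<in> carrier R" and m: "m \<in> carrier M" and am: "a \<odot>\<^bsub>M\<^esub> m \<in> ideal_smult M p" for a m
  proof (cases "a \<in> p")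
    case False
    obtain K where K: "ideal K R" "m \<in> ideal_smult M K"
      "\<And>k. k \<in> K \<Longrightarrow> a \<otimes> k \<in> colon R M (ideal_smult M p)"
      using cyclic_ideal_mult_le_colon[OF mult sub a m am] by blast
    then have "K \<subseteq> p"
      using False a p.I_prime ideal.Icarr[OF K(1)] unfolding colon by blast
    then have "m \<in> ideal_smult M p"
      using K(2) by (rule ideal_smult_mono[THEN subsetD])
    then show ?thesis ..
  qed simp
  ultimately show ?thesis
    using sub unfolding prime_submodule_def colon by blast
qed

lemma (in module) prime_submodule_colon_pow:
  assumes P: "prime_submodule R M P" and c: "c \<in> carrier R"
    and pow: "c [^] (n::nat) \<in> colon R M P"
  shows "c \<in> colon R M P"
  using pow
proof (induction n)
  case 0
  then have "carrier M \<subseteq> P" by (auto simp: colon_def)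
  moreover have "P \<subseteq> carrier M"
    using P submoduleE(1)[of P] by (simp add: prime_submodule_def)
  ultimately show ?case
    using P by (auto simp: prime_submodule_def)
next
  case (Suc n)
  show ?case
  proof (rule ccontr)
    assume nc: "c \<notin> colon R M P"
    have "c [^] n \<odot>\<^bsub>M\<^esub> m \<in> P" if m: "m \<in> carrier M" for m
    proof -
      have "c [^] Suc n = c \<otimes> c [^] n" using c by (simp add: R.m_comm)
      then have "c \<odot>\<^bsub>M\<^esub> (c [^] n \<odot>\<^bsub>M\<^esub> m) \<in> P"
        using Suc.prems m c by (simp add: colon_def smult_assoc1)
      then show ?thesis
        using P nc c m by (auto simp: prime_submodule_def)
    qed
    then have "c [^] n \<in> colon R M P" using c by (simp add: colon_def)
    with Suc.IH nc show False by blast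
  qed
qed

lemma (in module) module_radical_submodule: "submodule (module_radical R M N) R M"
proof (cases "\<exists>P. prime_submodule R M P \<and> N \<subseteq> P")
  case False
  then show ?thesis
    unfolding module_radical_def using carrier_is_submodule by (simp only: if_False)
next
  case True
  let ?PP = "{P. prime_submodule R M P \<and> N \<subseteq> P}"
  have sub: "submodule P R M" if "P \<in> ?PP" for P
    using that by (simp add: prime_submodule_def)
  have "submodule (\<Inter>?PP) R M"
  proof (rule submoduleI)
    show "\<Inter>?PP \<subseteq> carrier M"
      using True sub[THEN submoduleE(1)] by blast
  qed (use sub in \<open>fast intro: submodule_zero_closed submoduleE(3-5)\<close>)+
  with True show ?thesis by (simp only: module_radical_def if_True)
qed

text \<open>
  Residuals of prime submodules are closed under roots, which gives \<open>\<surd>I \<subseteq> (M-rad(IM) : M)\<close>.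
  Conversely, an element outside \<open>\<surd>I\<close> is missed by some prime ideal \<open>p \<supseteq> I\<close>; the prime
  submodule \<open>pM\<close> contains \<open>IM\<close>, and by cancellation its residual is \<open>p\<close>.
\<close>
lemma (in module) colon_module_radical:
  assumes mult: "multiplication_module R M" and fg: "finitely_generated_module R M"
    and faith: "faithful_module R M" and I: "ideal I R"
  shows "colon R M (module_radical R M (ideal_smult M I)) = ideal_radical R I"
proof
  interpret I: ideal I R by fact
  show "ideal_radical R I \<subseteq> colon R M (module_radical R M (ideal_smult M I))"
  proof
    fix c assume "c \<in> ideal_radical R I"
    then obtain n :: nat where c: "c \<in> carrier R" and n: "c [^] n \<in> I"
      by (auto simp: ideal_radical_def)
    have "c \<in> colon R M P" if P: "prime_submodule R M P" "ideal_smult M I \<subseteq> P" for P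
    proof -
      have "c [^] n \<in> colon R M P"
        using n c P(2) by (auto simp: colon_def intro: ideal_smult.smult)
      then show ?thesis using prime_submodule_colon_pow[OF P(1) c] by blast
    qed
    then show "c \<in> colon R M (module_radical R M (ideal_smult M I))"
      using c by (auto simp: colon_def module_radical_def)
  qed
  show "colon R M (module_radical R M (ideal_smult M I)) \<subseteq> ideal_radical R I"
  proof
    fix c assume c: "c \<in> colon R M (module_radical R M (ideal_smult M I))"
    show "c \<in> ideal_radical R I"
    proof (rule ccontr)
      assume "c \<notin> ideal_radical R I"
      then obtain p where p: "primeideal p R" "I \<subseteq> p" "c \<notin> p"
        using R.exists_prime_outside_radical[OF I] c by (auto simp: colon_def)
      have "prime_submodule R M (ideal_smult M p)"
        by (rule prime_ideal_smult[OF mult fg faith p(1)])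
      moreover have "ideal_smult M I \<subseteq> ideal_smult M p"
        by (rule ideal_smult_mono[OF p(2)])
      ultimately have "module_radical R M (ideal_smult M I) \<subseteq> ideal_smult M p"
        by (auto simp: module_radical_def)
      then have "c \<in> colon R M (ideal_smult M p)"
        using c by (auto simp: colon_def)
      then show False
        using colon_ideal_smult[OF mult fg faith primeideal.axioms(1)[OF p(1)]] p(3) by simp
    qed
  qed
qed

section \<open>1-absorbing primary ideals and submodules\<close>

text \<open>
  From left to right, replace \<open>m\<close> by an ideal \<open>K\<close> with \<open>m \<in> KM\<close> and \<open>abK \<subseteq> I\<close>: either
  \<open>ab \<in> I\<close> or all of \<open>K\<close> lies in \<open>\<surd>I = (M-rad(IM) : M)\<close>.  From right to left, apply the
  condition on \<open>IM\<close> to all the elements \<open>cm\<close> at once.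
\<close>
lemma (in module) one_absorbing_primary_ideal_smult_iff:
  assumes mult: "multiplication_module R M" and fg: "finitely_generated_module R M"
    and faith: "faithful_module R M" and I: "ideal I R"
  shows "one_absorbing_primary_ideal R I \<longleftrightarrow>
    one_absorbing_primary_submodule R M (ideal_smult M I)"
proof -
  interpret I: ideal I R by fact
  let ?rad = "module_radical R M (ideal_smult M I)"
  have sub: "submodule (ideal_smult M I) R M"
    by (rule ideal_smult_submodule[OF I])
  have colon: "colon R M (ideal_smult M I) = I"
    by (rule colon_ideal_smult[OF mult fg faith I])
  have rad: "colon R M ?rad = ideal_radical R I"
    by (rule colon_module_radical[OF mult fg faith I])
  have proper: "ideal_smult M I = carrier M \<longleftrightarrow> I = carrier R"
    using ideal_smult_eq_carrier_imp_one[OF mult fg faith I] I.one_imp_carrier ideal_smult_carrier by metis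
  show ?thesis
  proof
    assume prim: "one_absorbing_primary_ideal R I"
    have "a \<otimes> b \<in> I \<or> m \<in> ?rad"
      if a: "a \<in> carrier R - Units R" and b: "b \<in> carrier R - Units R" and m: "m \<in> carrier M"
        and abm: "(a \<otimes> b) \<odot>\<^bsub>M\<^esub> m \<in> ideal_smult M I" for a b m
    proof (cases "a \<otimes> b \<in> I")
      case False
      have ab: "a \<otimes> b \<in> carrier R" using a b by simp
      obtain K where K: "ideal K R" "m \<in> ideal_smult M K"
        "\<And>k. k \<in> K \<Longrightarrow> a \<otimes> b \<otimes> k \<in> I"
        using cyclic_ideal_mult_le_colon[OF mult sub ab m abm] colon by metis
      have "k \<in> ideal_radical R I" if k: "k \<in> K" for k
      proof (cases "k \<in> Units R")
        \<comment> \<open>The condition on \<open>I\<close> says nothing about a unit \<open>k\<close>, but a unit cancels.\<close>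
        case True
        have "a \<otimes> b \<otimes> k \<otimes> inv k \<in> I"
          by (rule I.I_r_closed[OF K(3)[OF k] R.Units_inv_closed[OF True]])
        moreover have "a \<otimes> b \<otimes> k \<otimes> inv k = a \<otimes> b"
          using True ab R.m_assoc[of "a \<otimes> b" k "inv k"] R.Units_closed[OF True] by simp
        ultimately show ?thesis using False by simp
      next
        case False
        then have "k \<in> carrier R - Units R" using ideal.Icarr[OF K(1) k] by simp
        then show ?thesis
          using prim a b K(3)[OF k] \<open>a \<otimes> b \<notin> I\<close>
          unfolding one_absorbing_primary_ideal_def by blast
      qed
      then have "K \<subseteq> colon R M ?rad" unfolding rad by blast
      then have "ideal_smult M K \<subseteq> ?rad"
        using ideal_smult_le_iff[OF module_radical_submodule] ideal.Icarr[OF K(1)] by blast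
      then show ?thesis using K(2) by blast
    qed blast
    moreover have "ideal_smult M I \<noteq> carrier M"
      using prim proper unfolding one_absorbing_primary_ideal_def by simp
    ultimately show "one_absorbing_primary_submodule R M (ideal_smult M I)"
      using sub unfolding one_absorbing_primary_submodule_def colon by blast
  next
    assume prim: "one_absorbing_primary_submodule R M (ideal_smult M I)"
    have "a \<otimes> b \<in> I \<or> c \<in> ideal_radical R I"
      if a: "a \<in> carrier R - Units R" and b: "b \<in> carrier R - Units R" and c: "c \<in> carrier R"
        and abc: "a \<otimes> b \<otimes> c \<in> I" for a b c
    proof (cases "a \<otimes> b \<in> I")
      case False
      have "c \<odot>\<^bsub>M\<^esub> m \<in> ?rad" if m: "m \<in> carrier M" for m
      proof -
        have "(a \<otimes> b) \<odot>\<^bsub>M\<^esub> (c \<odot>\<^bsub>M\<^esub> m) = (a \<otimes> b \<otimes> c) \<odot>\<^bsub>M\<^esub> m"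
          using a b c m by (simp add: smult_assoc1)
        then have "(a \<otimes> b) \<odot>\<^bsub>M\<^esub> (c \<odot>\<^bsub>M\<^esub> m) \<in> ideal_smult M I"
          using ideal_smult.smult[OF abc m] by simp
        then show ?thesis
          using prim a b c m False
          unfolding one_absorbing_primary_submodule_def colon by blast
      qed
      then have "c \<in> colon R M ?rad" using c by (simp add: colon_def)
      then show ?thesis unfolding rad by blast
    qed blast
    moreover have "I \<noteq> carrier R"
      using prim proper unfolding one_absorbing_primary_submodule_def by simp
    ultimately show "one_absorbing_primary_ideal R I"
      using I unfolding one_absorbing_primary_ideal_def by blast
  qed
qed

theorem theorem3:
  fixes R :: "('a, 'r) ring_scheme" and M :: "('a, 'b, 'm) module_scheme"
    and I :: "'a set" and N :: "'b set"
  assumes "cring R" and "\<one>\<^bsub>R\<^esub> \<noteq> \<zero>\<^bsub>R\<^esub>"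
    and "module R M"
    and "finitely_generated_module R M"
    and "faithful_module R M"
    and "multiplication_module R M"
    and "ideal I R"
    and "submodule N R M"
  shows "(one_absorbing_primary_ideal R I \<longleftrightarrow>
            one_absorbing_primary_submodule R M (ideal_smult M I)) \<and>
         (one_absorbing_primary_submodule R M N \<longleftrightarrow>
            one_absorbing_primary_ideal R (colon R M N)) \<and>
         (one_absorbing_primary_submodule R M N \<longleftrightarrow>
            (\<exists>J. one_absorbing_primary_ideal R J \<and> N = ideal_smult M J))"
proof -
  interpret module R M by fact
  note iff = one_absorbing_primary_ideal_smult_iff[OF assms(6,4,5)]
  have N: "N = ideal_smult M (colon R M N)"
    by (rule submodule_eq_colon_smult[OF assms(6,8)])
  have colon: "one_absorbing_primary_submodule R M N \<longleftrightarrow>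
      one_absorbing_primary_ideal R (colon R M N)"
    using iff[OF colon_ideal[OF assms(8)]] unfolding N[symmetric] by (rule sym)
  have "one_absorbing_primary_submodule R M N \<longleftrightarrow>
      (\<exists>J. one_absorbing_primary_ideal R J \<and> N = ideal_smult M J)"
  proof
    assume "one_absorbing_primary_submodule R M N"
    then have "one_absorbing_primary_ideal R (colon R M N)"
      by (simp only: colon)
    with N show "\<exists>J. one_absorbing_primary_ideal R J \<and> N = ideal_smult M J"
      by blast
  next
    assume "\<exists>J. one_absorbing_primary_ideal R J \<and> N = ideal_smult M J"
    then obtain J where J: "one_absorbing_primary_ideal R J" "N = ideal_smult M J"
      by blast
    then have "ideal J R"
      by (simp add: one_absorbing_primary_ideal_def)
    then show "one_absorbing_primary_submodule R M N"
      using iff J by simp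
  qed
  with iff[OF assms(7)] colon show ?thesis
    by blast
qed

end
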